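(* Let $(V,\langle\cdot,\cdot\rangle)$ be a real Hilbert space, and let $g,h:V\to\mathbb{R}$ be continuous quadratic functions given by $$g(x)=c_g+2\langle v_g,x\rangle+\langle x,M_g x\rangle,\qquad h(x)=c_h+2\langle v_h,x\rangle+\langle x,M_h x\rangle,$$ where $M_g,M_h:V\to V$ are self-adjoint operators, $v_g,v_h\in V$ and $c_g,c_h\in\mathbb{R}$. Assume that there exists $x_0\in V$ with $h(x_0)>0$. Then $g$ is copositive with $h$ if and only if there exists $\xi\ge 0$ such that $g(x)-\xi h(x)\ge 0$ for all $x\in V$.
   Context: A function $g:V\to\mathbb{R}$ is called copositive with a function $h:V\to\mathbb{R}$ if for every $x\in V$, $h(x)\ge 0$ implies $g(x)\ge 0$. The self-adjoint operators are everywhere defined on $V$ (hence bounded). *)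

theory Defs
  imports "HOL-Analysis.Analysis"
begin

text \<open>A real Hilbert space is a type of sort \<open>{real_inner, complete_space}\<close>; no separability or
  dimension assumption is made.\<close>

text \<open>For an operator defined on the whole space, equality with its adjoint (including equality of
  domains) amounts to linearity and symmetry. Boundedness is not part of the definition: on a
  Hilbert space it follows, by the Hellinger-Toeplitz theorem.\<close>

definition self_adjoint :: "('a::real_inner \<Rightarrow> 'a) \<Rightarrow> bool" where
  "self_adjoint M \<longleftrightarrow> linear M \<and> (\<forall>x y. M x \<bullet> y = x \<bullet> M y)"

definition copositive_with :: "('a \<Rightarrow> real) \<Rightarrow> ('a \<Rightarrow> real) \<Rightarrow> bool" where
  "copositive_with g h \<longleftrightarrow> (\<forall>x. h x \<ge> 0 \<longrightarrow> g x \<ge> 0)"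

end

theory Submission imports Defs begin

text \<open>Homogenise \<open>g\<close> and \<open>h\<close> to quadratic forms \<open>G\<close> and \<open>H\<close> on \<open>V \<times> \<real>\<close>; copositivity survives,
  the hyperplane at infinity being reached along rays from a point with \<open>h x\<^sub>0 > 0\<close>. The
  multiplier is \<open>\<xi> = inf {G z / H z | H z > 0}\<close>. It works because for \<open>H w < 0 < H z\<close> the form \<open>H\<close>
  has two zeros of opposite sign on the line \<open>z + s w\<close>; eliminating the mixed term of \<open>G\<close>
  from its nonnegativity at these two points gives \<open>G w / H w \<le> G z / H z\<close>.\<close>

lemma quadratic_nonneg_imp_leading_coeff_nonneg:
  fixes a b c :: real
  assumes nonneg: "\<And>s. s \<ge> 0 \<Longrightarrow> a + s * b + s\<^sup>2 * c \<ge> 0"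
  shows "c \<ge> 0"
proof (rule ccontr)
  assume "\<not> c \<ge> 0"
  then have c: "c < 0" by simp
  \<comment> \<open>Chosen so that \<open>s * c = c - \<bar>a\<bar> - \<bar>b\<bar>\<close>. As
    \<open>s \<ge> 1\<close>, the value of the quadratic at \<open>s\<close> is then at most
    \<open>s * c\<close>, which is negative.\<close>
  define s where "s = 1 + (\<bar>a\<bar> + \<bar>b\<bar>) / (- c)"
  have s: "s \<ge> 1"
    using c by (simp add: s_def divide_nonneg_neg)
  have "s * c = c - \<bar>a\<bar> - \<bar>b\<bar>"
    using c by (simp add: s_def field_simps)
  then have sq: "s\<^sup>2 * c = s * c - s * \<bar>a\<bar> - s * \<bar>b\<bar>"
    by (simp only: power2_eq_square mult.assoc right_diff_distrib)
  have "a \<le> s * \<bar>a\<bar>"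
    using s mult_right_mono[of 1 s "\<bar>a\<bar>"] by simp
  moreover have "s * b \<le> s * \<bar>b\<bar>"
    using s by (intro mult_left_mono) auto
  moreover have "s * c < 0"
    using s c by (simp add: mult_pos_neg)
  ultimately show False
    using nonneg[of s] s sq by linarith
qed

text \<open>As \<open>a * c < 0\<close>, the discriminant exceeds \<open>b\<^sup>2\<close>, so its
  root dominates \<open>\<bar>b\<bar>\<close> and fixes the sign of each solution. The product
  (Vieta) is recorded because it is all that survives of the roots once the mixed term is
  eliminated.\<close>

lemma quadratic_roots_opposite_sign:
  fixes a b c :: real
  assumes "a > 0" and "c < 0"
  obtains s t where "s < 0" and "0 < t" and "s * t = a / c"
    and "a + s * b + s\<^sup>2 * c = 0" and "a + t * b + t\<^sup>2 * c = 0"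
proof -
  define D where "D = sqrt (b\<^sup>2 - 4 * a * c)"
  have disc: "b\<^sup>2 < b\<^sup>2 - 4 * a * c"
    using assms by (simp add: mult_pos_neg)
  then have D2: "D\<^sup>2 = b\<^sup>2 - 4 * a * c"
    unfolding D_def by (intro real_sqrt_pow2 order.trans[OF zero_le_power2 less_imp_le])
  have "\<bar>b\<bar> < D"
    unfolding D_def using disc by (intro real_less_rsqrt) simp
  then have D: "D - b > 0" "D + b > 0" by auto
  \<comment> \<open>Both numerators are divided by \<open>2 * c < 0\<close>, so the positive one,
    \<open>D - b\<close>, gives the negative root.\<close>
  define s where "s = (D - b) / (2 * c)"
  define t where "t = (- D - b) / (2 * c)"
  have "s < 0"
    using D assms(2) by (simp add: s_def divide_pos_neg)
  moreover have "0 < t"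
    unfolding t_def using D assms(2) by (intro divide_neg_neg) auto
  moreover have "s * t = (b\<^sup>2 - D\<^sup>2) / (4 * c\<^sup>2)"
    by (simp add: s_def t_def power2_eq_square algebra_simps)
  then have "s * t = a / c"
    using assms(2) unfolding D2 by (simp add: power2_eq_square)
  moreover have "a + s * b + s\<^sup>2 * c = (D\<^sup>2 - (b\<^sup>2 - 4 * a * c)) / (4 * c)"
    using assms(2) by (simp add: s_def field_simps power2_eq_square)
  then have "a + s * b + s\<^sup>2 * c = 0"
    using D2 by simp
  moreover have "a + t * b + t\<^sup>2 * c = (D\<^sup>2 - (b\<^sup>2 - 4 * a * c)) / (4 * c)"
    using assms(2) by (simp add: t_def field_simps power2_eq_square)
  then have "a + t * b + t\<^sup>2 * c = 0"
    using D2 by simp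
  ultimately show thesis
    by (rule that)
qed

lemma bilinear_diag_line:
  fixes B :: "'a::real_vector \<Rightarrow> 'a \<Rightarrow> real"
  assumes "bilinear B"
  shows "B (z + s *\<^sub>R w) (z + s *\<^sub>R w) = B z z + s * (B z w + B w z) + s\<^sup>2 * B w w"
  using assms
  by (simp add: bilinear_ladd bilinear_radd bilinear_lmul bilinear_rmul power2_eq_square algebra_simps)

lemma bilinear_copositive_cross:
  fixes A B :: "'a::real_vector \<Rightarrow> 'a \<Rightarrow> real"
  assumes "bilinear A" and "bilinear B"
    and cop: "\<And>z. B z z \<ge> 0 \<Longrightarrow> A z z \<ge> 0"
    and pos: "B z z > 0" and neg: "B w w < 0"
  shows "A w w / B w w \<le> A z z / B z z"
proof -
  obtain s t where st: "s < 0" "0 < t" "s * t = B z z / B w w"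
    and roots: "B z z + s * (B z w + B w z) + s\<^sup>2 * B w w = 0"
      "B z z + t * (B z w + B w z) + t\<^sup>2 * B w w = 0"
    using quadratic_roots_opposite_sign[OF pos neg] by metis
  define m where "m = A z w + A w z"
  have "A z z + r * m + r\<^sup>2 * A w w \<ge> 0"
    if "B z z + r * (B z w + B w z) + r\<^sup>2 * B w w = 0" for r
    using cop[of "z + r *\<^sub>R w"] that assms(1,2) by (simp add: bilinear_diag_line m_def)
  from this[OF roots(1)] this[OF roots(2)]
  \<comment> \<open>The weights \<open>t\<close> and \<open>- s\<close> are positive, so the sum
    stays nonnegative, and they make the two terms in \<open>m\<close> cancel.\<close>
  have "t * (A z z + s * m + s\<^sup>2 * A w w) + (- s) * (A z z + t * m + t\<^sup>2 * A w w) \<ge> 0"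
    using st by (intro add_nonneg_nonneg[OF mult_nonneg_nonneg mult_nonneg_nonneg]) auto
  also have "t * (A z z + s * m + s\<^sup>2 * A w w) + (- s) * (A z z + t * m + t\<^sup>2 * A w w)
      = (t - s) * (A z z - s * t * A w w)"
    by (simp add: algebra_simps power2_eq_square)
  finally have "A z z - s * t * A w w \<ge> 0"
    using st by (simp add: zero_le_mult_iff)
  then have "A z z \<ge> B z z * (A w w / B w w)"
    by (simp add: st(3))
  then show ?thesis
    using pos by (simp add: pos_le_divide_eq mult.commute)
qed

lemma S_lemma_homogeneous:
  fixes A B :: "'a::real_vector \<Rightarrow> 'a \<Rightarrow> real"
  assumes "bilinear A" and "bilinear B"
    and cop: "\<And>z. B z z \<ge> 0 \<Longrightarrow> A z z \<ge> 0"
    and z\<^sub>0: "B z\<^sub>0 z\<^sub>0 > 0"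
  shows "\<exists>\<xi>\<ge>0. \<forall>z. A z z - \<xi> * B z z \<ge> 0"
proof -
  define R where "R = (\<lambda>z. A z z / B z z) ` {z. B z z > 0}"
  have R_ne: "R \<noteq> {}"
    using z\<^sub>0 by (auto simp: R_def)
  have R_nonneg: "r \<ge> 0" if "r \<in> R" for r
    using that cop by (auto simp: R_def)
  then have R_bdd: "bdd_below R"
    by (rule bdd_belowI)
  have "A z z - Inf R * B z z \<ge> 0" for z
  proof (cases "B z z" "0 :: real" rule: linorder_cases)
    case less
    \<comment> \<open>By the cross inequality this ratio is a lower bound of \<open>R\<close>.
      Multiplying by the negative \<open>B z z\<close> then reverses the inequality.\<close>
    then have "A z z / B z z \<le> Inf R"
      by (intro cInf_greatest[OF R_ne])
        (auto simp: R_def intro: bilinear_copositive_cross[OF assms(1-3)])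
    then show ?thesis
      using less by (simp add: neg_divide_le_eq)
  next
    case equal
    then show ?thesis
      using cop[of z] by simp
  next
    case greater
    then have "Inf R \<le> A z z / B z z"
      by (intro cInf_lower[OF _ R_bdd]) (auto simp: R_def)
    then show ?thesis
      using greater by (simp add: pos_le_divide_eq)
  qed
  moreover have "Inf R \<ge> 0"
    using R_nonneg by (intro cInf_greatest[OF R_ne])
  ultimately show ?thesis
    by blast
qed

text \<open>Off the hyperplane \<open>snd z = 0\<close>, every point is a multiple of a slice point,
  and both forms scale by a square. A direction \<open>w\<close> in the hyperplane is tested along
  the ray \<open>(x\<^sub>0, 1) + s *\<^sub>R w\<close>, which stays in the slice;
  \<open>A w w\<close> is the leading coefficient of \<open>A\<close> along it.\<close>

lemma copositive_affine_slice_imp_copositive: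
  fixes A B :: "'a::real_vector \<times> real \<Rightarrow> 'a \<times> real \<Rightarrow> real"
  assumes A: "bilinear A" and B: "bilinear B"
    and slice: "\<And>x. B (x, 1) (x, 1) \<ge> 0 \<Longrightarrow> A (x, 1) (x, 1) \<ge> 0"
    and x\<^sub>0: "B (x\<^sub>0, 1) (x\<^sub>0, 1) > 0"
    and z: "B z z \<ge> 0"
  shows "A z z \<ge> 0"
proof (cases "snd z = 0")
  case False
  define r where "r = snd z"
  define x where "x = fst z /\<^sub>R r"
  have r: "r \<noteq> 0" and z_eq: "z = r *\<^sub>R (x, 1)"
    using False by (simp_all add: r_def x_def prod_eq_iff)
  have scale: "C z z = r\<^sup>2 * C (x, 1) (x, 1)"
    if "bilinear C" for C :: "'a \<times> real \<Rightarrow> 'a \<times> real \<Rightarrow> real"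
    unfolding z_eq bilinear_lmul[OF that] bilinear_rmul[OF that] by (simp add: power2_eq_square)
  have "B (x, 1) (x, 1) \<ge> 0"
    using z r by (simp add: scale[OF B] zero_le_mult_iff)
  then show ?thesis
    using slice by (simp add: scale[OF A])
next
  case True
  let ?p = "(x\<^sub>0, 1) :: 'a \<times> real"
  \<comment> \<open>The sign condition on the mixed term keeps \<open>B\<close> nonnegative on the
    whole ray \<open>s \<ge> 0\<close>. It costs nothing: replacing \<open>w\<close> by
    \<open>- w\<close> flips the mixed term and leaves \<open>A w w\<close> and \<open>B w w\<close>
    unchanged.\<close>
  have main: "A w w \<ge> 0" if w: "snd w = 0" "B w w \<ge> 0" "B ?p w + B w ?p \<ge> 0" for w
  proof (rule quadratic_nonneg_imp_leading_coeff_nonneg)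
    fix s :: real
    assume "s \<ge> 0"
    have line: "?p + s *\<^sub>R w = (x\<^sub>0 + s *\<^sub>R fst w, 1)"
      using w(1) by (simp add: prod_eq_iff)
    have "B (?p + s *\<^sub>R w) (?p + s *\<^sub>R w) \<ge> 0"
      unfolding bilinear_diag_line[OF B] using x\<^sub>0 w \<open>s \<ge> 0\<close> by simp
    then have "A (?p + s *\<^sub>R w) (?p + s *\<^sub>R w) \<ge> 0"
      unfolding line by (rule slice)
    then show "A ?p ?p + s * (A ?p w + A w ?p) + s\<^sup>2 * A w w \<ge> 0"
      unfolding bilinear_diag_line[OF A] .
  qed
  show ?thesis
  proof (cases "B ?p z + B z ?p \<ge> 0")
    case True
    with \<open>snd z = 0\<close> z show ?thesis by (intro main)
  next
    case False
    with \<open>snd z = 0\<close> z have "A (- z) (- z) \<ge> 0"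
      using B by (intro main) (auto simp: bilinear_lneg bilinear_rneg)
    then show ?thesis
      using A by (simp add: bilinear_lneg bilinear_rneg)
  qed
qed

text \<open>The linear term is split evenly between the two arguments, so the diagonal at
  \<open>(x, 1)\<close> is \<open>c + 2 * (v \<bullet> x) + x \<bullet> M x\<close>.\<close>

lemma bilinear_homogenization:
  fixes M :: "'a::real_inner \<Rightarrow> 'a"
  assumes "linear M"
  shows "bilinear (\<lambda>p q. c * snd p * snd q + snd q * (v \<bullet> fst p) + snd p * (v \<bullet> fst q)
    + fst p \<bullet> M (fst q))"
  using assms
  by (auto simp: bilinear_def linear_iff inner_add_left inner_add_right algebra_simps)

theorem theorem2p11:
  fixes g h :: "'a::{real_inner, complete_space} \<Rightarrow> real"
    and M\<^sub>g M\<^sub>h :: "'a \<Rightarrow> 'a"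
    and v\<^sub>g v\<^sub>h :: 'a
    and c\<^sub>g c\<^sub>h :: real
  assumes "self_adjoint M\<^sub>g" and "self_adjoint M\<^sub>h"
    and "\<And>x. g x = c\<^sub>g + 2 * (v\<^sub>g \<bullet> x) + x \<bullet> M\<^sub>g x"
    and "\<And>x. h x = c\<^sub>h + 2 * (v\<^sub>h \<bullet> x) + x \<bullet> M\<^sub>h x"
    and "continuous_on UNIV g" and "continuous_on UNIV h"
    and "\<exists>x\<^sub>0. h x\<^sub>0 > 0"
  shows "copositive_with g h \<longleftrightarrow> (\<exists>\<xi>\<ge>0. \<forall>x. g x - \<xi> * h x \<ge> 0)"
proof
  assume cop: "copositive_with g h"
  define F where "F c v M p q =
      c * snd p * snd q + snd q * (v \<bullet> fst p) + snd p * (v \<bullet> fst q) + fst p \<bullet> M (fst q)"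
    for c :: real and v :: 'a and M and p q :: "'a \<times> real"
  let ?A = "F c\<^sub>g v\<^sub>g M\<^sub>g" and ?B = "F c\<^sub>h v\<^sub>h M\<^sub>h"
  have A: "bilinear ?A" and B: "bilinear ?B"
    using assms(1,2) unfolding F_def self_adjoint_def by (auto intro: bilinear_homogenization)
  have g: "?A (x, 1) (x, 1) = g x" and h: "?B (x, 1) (x, 1) = h x" for x
    by (simp_all add: F_def assms(3,4))
  obtain x\<^sub>0 where x\<^sub>0: "?B (x\<^sub>0, 1) (x\<^sub>0, 1) > 0"
    using assms(7) h by auto
  have "?A (x, 1) (x, 1) \<ge> 0" if "?B (x, 1) (x, 1) \<ge> 0" for x
    using cop that unfolding copositive_with_def g h by blast
  note copositive = copositive_affine_slice_imp_copositive[OF A B this x\<^sub>0]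
  from S_lemma_homogeneous[OF A B copositive x\<^sub>0]
  show "\<exists>\<xi>\<ge>0. \<forall>x. g x - \<xi> * h x \<ge> 0"
    unfolding g[symmetric] h[symmetric] by blast
next
  assume "\<exists>\<xi>\<ge>0. \<forall>x. g x - \<xi> * h x \<ge> 0"
  then show "copositive_with g h"
    \<comment> \<open>Here \<open>g x\<close> is the sum of \<open>g x - \<xi> * h x\<close> and
      \<open>\<xi> * h x\<close>, both nonnegative when \<open>h x \<ge> 0\<close>.\<close>
    unfolding copositive_with_def by (smt (verit) mult_nonneg_nonneg)
qed

end
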